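(* Let $B\ge1$ and $G=|\mathcal G|\ge 1$ be integers and $\rho>0$. The average rate of the ACC scheme over symmetric quasi-static Rayleigh fading is exactly $$\bar R^{(\mathrm{ACC})}=\frac{G}{B\ln 2}\int_0^\infty\left(\frac12+\frac1\pi\int_0^\infty\frac{\mathrm{Im}\left\{\exp(-\jmath y t)\,\frac{\exp(B/\rho)}{\rho^B}\,\Big(\mathrm E_{-\jmath t}\big(\tfrac1\rho\big)\Big)^{B}\right\}}{t}\,\mathrm dt\right)^{G}\mathrm dy .$$
   Context: Setting: users are divided into $\Lambda$ groups of $B$ users each. $\gamma\in[0,1]$ is the normalized cache size, $\Lambda\gamma$ is an integer with $\Lambda\gamma+1\le\Lambda$, and $\mathcal G\subseteq\{1,\dots,\Lambda\}$ is a set of $G=|\mathcal G|=\Lambda\gamma+1$ groups served simultaneously. $\mathrm{SNR}_{g,b}$ denotes the instantaneous SNR of the $b$-th user of group $g$. These are i.i.d. exponential random variables with mean $\rho>0$ (density $\frac1\rho e^{-x/\rho}$, $x\ge0$). The average rate of the ACC (Aggregated Coded Caching) scheme is $$\bar R^{(\mathrm{ACC})}=\frac{G}{\ln2}\,\mathbb E\Big\{\min_{g\in\mathcal G}\frac1B\sum_{b=1}^B\ln(1+\mathrm{SNR}_{g,b})\Big\}.$$ Notation: $\jmath=\sqrt{-1}$; $\mathrm{Im}$ is the imaginary part; $\mathrm E_{\nu}(z)=\int_1^\infty u^{-\nu}e^{-zu}\,\mathrm du$ (for $z>0$, $\nu\in\mathbb C$) is the exponential integral function of order $\nu$, so $\mathrm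 E_{-\jmath t}(1/\rho)=\int_1^\infty u^{\jmath t}e^{-u/\rho}\,\mathrm du$. *)

theory Defs
  imports "HOL-Probability.Probability"
begin

text \<open>
  Exponential integral of complex order, for a positive real argument. As \<open>u\<close> is positive,
  the principal-value \<^term>\<open>(powr)\<close> is \<open>u\<close> to the \<open>- \<nu>\<close> computed with the real logarithm.
\<close>

definition expint_E :: "complex \<Rightarrow> real \<Rightarrow> complex" where
  "expint_E \<nu> z =
     (LINT u:{1..}|lborel. complex_of_real u powr (- \<nu>) * complex_of_real (exp (- z * u)))"

definition acc_min_rate ::
  "(nat \<Rightarrow> nat \<Rightarrow> 'w \<Rightarrow> real) \<Rightarrow> nat \<Rightarrow> nat set \<Rightarrow> 'w \<Rightarrow> real" where
  "acc_min_rate SNR B \<G> \<omega> =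
     (MIN g\<in>\<G>. 1 / real B * (\<Sum>b=1..B. ln (1 + SNR g b \<omega>)))"

definition acc_avg_rate ::
  "'w measure \<Rightarrow> (nat \<Rightarrow> nat \<Rightarrow> 'w \<Rightarrow> real) \<Rightarrow> nat \<Rightarrow> nat set \<Rightarrow> real" where
  "acc_avg_rate M SNR B \<G> =
     real (card \<G>) / ln 2 * (\<integral>\<omega>. acc_min_rate SNR B \<G> \<omega> \<partial>M)"

definition acc_integrand :: "nat \<Rightarrow> real \<Rightarrow> real \<Rightarrow> real \<Rightarrow> real" where
  "acc_integrand B \<rho> y t =
     Im (exp (- \<i> * complex_of_real y * complex_of_real t)
         * complex_of_real (exp (real B / \<rho>) / \<rho> ^ B)
         * expint_E (- \<i> * complex_of_real t) (1 / \<rho>) ^ B) / t"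

end

theory Submission
  imports Defs
begin

text \<open>
  Let \<open>S\<^sub>g\<close> be the sum of \<open>ln (1 + SNR g b)\<close> over \<open>b\<close>. Its characteristic function is the \<open>B\<close>-th power of
  that of \<open>ln (1 + SNR)\<close>, which the substitution \<open>u = 1 + x\<close> turns into an exponential integral of
  imaginary order. The Gil-Pelaez inversion formula then recovers \<open>P (S\<^sub>g > y)\<close> as the inner
  expression, and since the \<open>S\<^sub>g\<close> are independent, its \<open>G\<close>-th power is the tail of their minimum,
  whose integral over \<open>y\<close> is the mean. For the inner integral to converge absolutely, the integrand
  is bounded near 0 because \<open>S\<^sub>g\<close> has a mean, and decays like \<open>1 / t\<^sup>2\<close> at infinity because one
  integration by parts shows that the characteristic function is \<open>O (1 / t)\<close> (already for \<open>B = 1\<close>).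
\<close>

section \<open>Gil-Pelaez inversion\<close>

text \<open>From \<open>\<bar>sin u\<bar> \<le> \<bar>u\<bar>\<close>; at \<open>t = 0\<close> the
  quotient is \<open>0\<close> by convention. Since the bound is free of \<open>t\<close>, it
  controls the inversion integrand near \<open>t = 0\<close>.\<close>

lemma abs_sin_mult_divide_le:
  fixes t \<theta> :: real
  shows "\<bar>sin (t * \<theta>) / t\<bar> \<le> \<bar>\<theta>\<bar>"
  using abs_sin_x_le_abs_x[of "t * \<theta>"] by (cases "t = 0") (auto simp: abs_mult field_simps)

text \<open>The phase factor recentres the distribution at \<open>y\<close>, and the imaginary part
  passes under the integral.\<close>

lemma (in real_distribution) Im_iexp_mult_char:
  "Im (iexp (- (y * t)) * char M t) = (\<integral>x. sin (t * (x - y)) \<partial>M)"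
proof -
  have int: "integrable M (\<lambda>x. iexp (t * (x - y)))"
    using integrable_iexp[of "\<lambda>x. of_real (t * (x - y))"] by simp
  have "iexp (- (y * t)) * char M t = (\<integral>x. iexp (- (y * t)) * iexp (t * x) \<partial>M)"
    unfolding char_def by (rule integral_mult_right_zero[symmetric])
  also have "\<dots> = (\<integral>x. iexp (t * (x - y)) \<partial>M)"
    by (intro Bochner_Integration.integral_cong refl)
       (simp add: exp_add[symmetric] algebra_simps)
  finally show ?thesis
    using int by (simp add: Im_exp flip: integral_Im)
qed

lemma (in real_distribution) integrable_sin_mult:
  "integrable M (\<lambda>x. sin (t * (x - y)) / s)"
  by (intro integrable_const_bound[where B="1 / \<bar>s\<bar>"]) (auto intro!: divide_right_mono)

context real_distribution
begin

context
  fixes y C :: real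
  assumes moment: "integrable M (\<lambda>x. x)"
    and decay: "\<And>t. 1 \<le> t \<Longrightarrow> cmod (char M t) \<le> C / t"
begin

text \<open>Each hypothesis handles one end of the ray: \<open>moment\<close> bounds the integrand
  by the mean of \<open>\<bar>x - y\<bar>\<close>, which suffices on \<open>{0<..1}\<close>, and
  \<open>decay\<close> bounds it by \<open>C / t^2\<close> beyond \<open>1\<close>.\<close>

lemma Gil_Pelaez_integrable:
  "set_integrable lborel {0<..} (\<lambda>t. Im (iexp (- (y * t)) * char M t) / t)" (is "set_integrable _ _ ?h")
proof -
  have [measurable]: "?h \<in> borel_measurable borel"
    by measurable
  define K where "K = (\<integral>x. \<bar>x - y\<bar> \<partial>M)"
  have K: "\<bar>?h t\<bar> \<le> K" for t
  proof -
    have "?h t = (\<integral>x. sin (t * (x - y)) / t \<partial>M)"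
      unfolding Im_iexp_mult_char by simp
    also have "\<bar>\<dots>\<bar> \<le> (\<integral>x. \<bar>sin (t * (x - y)) / t\<bar> \<partial>M)"
      by (rule integral_abs_bound)
    also have "\<dots> \<le> K"
      unfolding K_def using moment
      by (intro integral_mono integrable_abs integrable_sin_mult Bochner_Integration.integrable_diff
          abs_sin_mult_divide_le) auto
    finally show ?thesis .
  qed
  have 1: "set_integrable lborel {0<..1} ?h"
    unfolding set_integrable_def
  proof (rule integrableI_bounded_set_indicator[where B=K])
    show "AE t in lborel. t \<in> {0<..1} \<longrightarrow> norm (?h t) \<le> K"
      unfolding real_norm_def using K by blast
  qed simp_all
  have 2: "set_integrable lborel {1<..} ?h"
  proof (rule set_integrable_bound)
    \<comment> \<open>The antiderivative \<open>- (1 / x)\<close> of \<open>1 / x^2\<close> rises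
      from \<open>-1\<close> at \<open>1\<close> to \<open>0\<close> at infinity, so the dominating
      function is integrable.\<close>
    have "((\<lambda>x::real. - (1 / x)) \<longlongrightarrow> 0) at_top"
      by real_asymp
    then have "set_integrable lborel (einterval 1 \<infinity>) (\<lambda>t::real. 1 / t^2)"
      by (intro interval_integral_FTC_nonneg(1)[where F="\<lambda>x. - (1 / x)" and A="-1" and B=0])
         (auto intro!: derivative_eq_intros tendsto_eq_intros
            simp: power2_eq_square one_ereal_def ereal_tendsto_simps1)
    then have "set_integrable lborel {1<..} (\<lambda>t::real. 1 / t^2)"
      by (simp add: einterval_def one_ereal_def greaterThan_def)
    then show "set_integrable lborel {1<..} (\<lambda>t::real. C * (1 / t^2))"
      by (rule set_integrable_mult_right)
    show "set_borel_measurable lborel {1<..} ?h"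
      by (simp add: set_borel_measurable_def)
    have "\<bar>?h t\<bar> \<le> C * (1 / t^2)" if "1 < t" for t
    proof -
      have "\<bar>Im (iexp (- (y * t)) * char M t)\<bar> \<le> cmod (iexp (- (y * t)) * char M t)"
        by (rule abs_Im_le_cmod)
      also have "\<dots> = cmod (char M t)"
        by (simp only: norm_mult norm_exp_i_times mult_1)
      also have "\<dots> \<le> C / t"
        using decay that by simp
      finally have "\<bar>?h t\<bar> \<le> (C / t) / t"
        using that unfolding abs_divide by (intro frac_le) auto
      then show ?thesis
        by (simp add: power2_eq_square)
    qed
    then show "AE t in lborel. t \<in> {1<..} \<longrightarrow> norm (?h t) \<le> norm (C * (1 / t^2))"
      by (intro AE_I2) (metis abs_ge_self greaterThan_iff order_trans real_norm_def)
  qed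
  have "{0<..} = {0<..1::real} \<union> {1<..}"
    by auto
  with set_integrable_Un[OF 1 2] show ?thesis
    by simp
qed

text \<open>Cutting off at \<open>n\<close> makes Fubini applicable: the double integrand is at most
  \<open>\<bar>x - y\<bar>\<close>, whose mean is finite, over a \<open>t\<close>-range of finite
  length. The inner integral is then a rescaled sine integral.\<close>

lemma Gil_Pelaez_truncated:
  "(LINT t:{0<..real n}|lborel. Im (iexp (- (y * t)) * char M t) / t)
     = (\<integral>x. sgn (x - y) * Si (real n * \<bar>x - y\<bar>) \<partial>M)"
proof -
  interpret P: pair_sigma_finite lborel M ..
  define K where "K = (\<integral>x. \<bar>x - y\<bar> \<partial>M)"
  let ?f = "\<lambda>t x. indicat_real {0<..real n} t * (sin (t * (x - y)) / t)"
  have int: "integrable M (?f t)" for t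
    by (intro integrable_mult_right integrable_sin_mult)
  have K: "(\<integral>x. norm (?f t x) \<partial>M) \<le> K * indicator {0<..real n} t" for t
  proof -
    have "(\<integral>x. norm (?f t x) \<partial>M) \<le> (\<integral>x. \<bar>x - y\<bar> * indicator {0<..real n} t \<partial>M)"
      using moment
      by (intro integral_mono integrable_norm int integrable_mult_left integrable_abs
          Bochner_Integration.integrable_diff)
         (auto split: split_indicator simp: abs_sin_mult_divide_le simp flip: abs_divide)
    then show ?thesis
      by (simp add: K_def)
  qed
  have F: "integrable (lborel \<Otimes>\<^sub>M M) (\<lambda>(t, x). ?f t x)"
  proof (rule P.Fubini_integrable)
    show "(\<lambda>(t, x). ?f t x) \<in> borel_measurable (lborel \<Otimes>\<^sub>M M)"
      by measurable
    show "AE t in lborel. integrable M (\<lambda>x. case (t, x) of (t, x) \<Rightarrow> ?f t x)"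
      using int by simp
    have "integrable lborel (\<lambda>t. \<integral>x. norm (?f t x) \<partial>M)"
    proof (rule Bochner_Integration.integrable_bound)
      show "integrable lborel (\<lambda>t. K * indicator {0<..real n} t)"
        by (intro integrable_mult_right) (simp add: integrable_indicator_iff)
      show "AE t in lborel. norm (\<integral>x. norm (?f t x) \<partial>M) \<le> norm (K * indicator {0<..real n} t)"
      proof (rule AE_I2)
        fix t
        have "0 \<le> (\<integral>x. norm (?f t x) \<partial>M)"
          by simp
        then show "norm (\<integral>x. norm (?f t x) \<partial>M) \<le> norm (K * indicator {0<..real n} t)"
          using K[of t] unfolding real_norm_def by linarith
      qed
    qed measurable
    then show "integrable lborel (\<lambda>t. \<integral>x. norm (case (t, x) of (t, x) \<Rightarrow> ?f t x) \<partial>M)"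
      by simp
  qed
  have "(LINT t:{0<..real n}|lborel. Im (iexp (- (y * t)) * char M t) / t) = (\<integral>t. \<integral>x. ?f t x \<partial>M \<partial>lborel)"
    unfolding set_lebesgue_integral_def Im_iexp_mult_char by simp
  also have "\<dots> = (\<integral>x. \<integral>t. ?f t x \<partial>lborel \<partial>M)"
    by (rule P.Fubini_integral[OF F, symmetric])
  also have "\<dots> = (\<integral>x. sgn (x - y) * Si (real n * \<bar>x - y\<bar>) \<partial>M)"
  proof (intro Bochner_Integration.integral_cong refl)
    fix x
    have "(\<integral>t. ?f t x \<partial>lborel) = (LBINT t=ereal 0..ereal (real n). sin (t * (x - y)) / t)"
      by (simp add: interval_integral_Ioc set_lebesgue_integral_def)
    also have "\<dots> = sgn (x - y) * Si (real n * \<bar>x - y\<bar>)"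
      \<comment> \<open>Sine is odd, so the sign of \<open>x - y\<close> comes out; scaling
        \<open>t\<close> by \<open>\<bar>x - y\<bar>\<close> leaves \<open>Si\<close>.\<close>
      using LBINT_I0c_sin_scale_divide[of "real n" "x - y"] by (simp add: zero_ereal_def)
    finally show "(\<integral>t. ?f t x \<partial>lborel) = sgn (x - y) * Si (real n * \<bar>x - y\<bar>)" .
  qed
  finally show ?thesis .
qed

text \<open>Dominated convergence: \<open>Si\<close> is bounded and tends to \<open>pi / 2\<close>
  at infinity.\<close>

lemma integral_Si_tendsto:
  "(\<lambda>n. \<integral>x. sgn (x - y) * Si (real n * \<bar>x - y\<bar>) \<partial>M)
     \<longlonglongrightarrow> pi / 2 * (measure M {y<..} - measure M {..<y})"
proof -
  obtain b where b: "\<And>T. \<bar>Si T\<bar> \<le> b"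
    using bounded_Si by auto
  have b0: "0 \<le> b"
    using b[of 0] by simp
  have "(\<lambda>n. \<integral>x. sgn (x - y) * Si (real n * \<bar>x - y\<bar>) \<partial>M)
     \<longlonglongrightarrow> (\<integral>x. pi / 2 * (indicator {y<..} x - indicator {..<y} x) \<partial>M)"
  proof (rule integral_dominated_convergence[where w="\<lambda>_. b"])
    show "AE x in M. (\<lambda>n. sgn (x - y) * Si (real n * \<bar>x - y\<bar>))
        \<longlonglongrightarrow> pi / 2 * (indicator {y<..} x - indicator {..<y} x)"
    proof (intro AE_I2)
      fix x
      show "(\<lambda>n. sgn (x - y) * Si (real n * \<bar>x - y\<bar>))
        \<longlonglongrightarrow> pi / 2 * (indicator {y<..} x - indicator {..<y} x)"
      \<comment> \<open>At \<open>x = y\<close> the sign is \<open>0\<close> and so are both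
        indicators. This is why an atom at \<open>y\<close> enters the inversion formula with weight
        one half.\<close>
      proof (cases "x = y")
        case False
        then have "(\<lambda>n. sgn (x - y) * Si (\<bar>x - y\<bar> * real n)) \<longlonglongrightarrow> sgn (x - y) * (pi / 2)"
          by (intro tendsto_intros filterlim_compose[OF Si_at_top]
              filterlim_tendsto_pos_mult_at_top[OF tendsto_const] filterlim_real_sequentially) auto
        moreover have "sgn (x - y) * (pi / 2) = pi / 2 * (indicator {y<..} x - indicator {..<y} x)"
          using False by (auto simp: sgn_if)
        ultimately show ?thesis
          by (simp add: mult.commute)
      qed simp
    qed
    show "AE x in M. norm (sgn (x - y) * Si (real n * \<bar>x - y\<bar>)) \<le> b" for n
      using b b0 by (intro AE_I2) (auto simp: abs_mult abs_sgn_eq)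
  qed simp_all
  also have "(\<integral>x. pi / 2 * (indicator {y<..} x - indicator {..<y} x) \<partial>M)
      = pi / 2 * (measure M {y<..} - measure M {..<y})"
    by (subst integral_mult_right_zero, subst Bochner_Integration.integral_diff)
       (auto intro!: integrable_const_bound[where B=1])
  finally show ?thesis .
qed

text \<open>Absolute integrability makes the integral over the ray the limit of the truncated ones,
  and that limit is already known in terms of \<open>Si\<close>.\<close>

lemma Gil_Pelaez_integral:
  "(LINT t:{0<..}|lborel. Im (iexp (- (y * t)) * char M t) / t)
     = pi / 2 * (measure M {y<..} - measure M {..<y})" (is "(LINT t:_|_. ?h t) = _")
proof (rule LIMSEQ_unique[OF _ integral_Si_tendsto])
  have "(\<lambda>n. \<integral>t. indicator {..real n} t *\<^sub>R (indicator {0<..} t *\<^sub>R ?h t) \<partial>lborel)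
     \<longlonglongrightarrow> (LINT t:{0<..}|lborel. ?h t)"
    unfolding set_lebesgue_integral_def using Gil_Pelaez_integrable
    by (intro filterlim_compose[OF tendsto_integral_at_top filterlim_real_sequentially])
       (auto simp: set_integrable_def)
  also have "(\<lambda>n. \<integral>t. indicator {..real n} t *\<^sub>R (indicator {0<..} t *\<^sub>R ?h t) \<partial>lborel)
     = (\<lambda>n. \<integral>x. sgn (x - y) * Si (real n * \<bar>x - y\<bar>) \<partial>M)"
    unfolding Gil_Pelaez_truncated[symmetric] set_lebesgue_integral_def
    by (intro ext Bochner_Integration.integral_cong) (auto split: split_indicator)
  finally show "(\<lambda>n. \<integral>x. sgn (x - y) * Si (real n * \<bar>x - y\<bar>) \<partial>M)
     \<longlonglongrightarrow> (LINT t:{0<..}|lborel. ?h t)" .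
qed

text \<open>The total mass is \<open>1\<close>, which eliminates the mass of \<open>{..<y}\<close>
  from the difference of the two tails.\<close>

theorem Gil_Pelaez:
  "1 / 2 + 1 / pi * (LINT t:{0<..}|lborel. Im (iexp (- (y * t)) * char M t) / t)
     = measure M {y<..} + measure M {y} / 2"
proof -
  have "measure M ({y<..} \<union> {..<y} \<union> {y}) = measure M {y<..} + measure M {..<y} + measure M {y}"
    by (subst finite_measure_Union, simp, simp, force, subst finite_measure_Union) auto
  moreover have "{y<..} \<union> {..<y} \<union> {y} = UNIV"
    by auto
  ultimately have "measure M {..<y} = 1 - measure M {y<..} - measure M {y}"
    using prob_space by simp
  then show ?thesis
    unfolding Gil_Pelaez_integral by (simp add: add_divide_distrib diff_divide_distrib)
qed

end

end

section \<open>The mean as the integral of the tail\<close>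

text \<open>Tonelli on the region \<open>0 < y < Y x\<close>: its slice at almost every
  \<open>x\<close> has length \<open>Y x\<close>, and its slice at \<open>y > 0\<close> has the tail
  as its probability.\<close>

lemma (in prob_space) layer_cake:
  fixes Y :: "'a \<Rightarrow> real"
  assumes int: "integrable M Y" and nonneg: "AE x in M. 0 \<le> Y x"
  shows "set_integrable lborel {0<..} (\<lambda>y. prob {x \<in> space M. y < Y x})"
    and "expectation Y = (LINT y:{0<..}|lborel. prob {x \<in> space M. y < Y x})"
proof -
  interpret P: pair_sigma_finite M lborel ..
  have [measurable]: "Y \<in> borel_measurable M"
    using int by simp
  let ?g = "\<lambda>y. indicator {0<..} y * prob {x \<in> space M. y < Y x}"
  have "(\<integral>\<^sup>+x. Y x \<partial>M) = (\<integral>\<^sup>+x. \<integral>\<^sup>+y. indicator {0<..<Y x} y \<partial>lborel \<partial>M)"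
    using nonneg by (intro nn_integral_cong_AE) auto
  \<comment> \<open>The conditional exhibits the integrand as a jointly measurable function of the
    pair, as Tonelli requires.\<close>
  also have "\<dots> = (\<integral>\<^sup>+x. \<integral>\<^sup>+y. (if 0 < y \<and> y < Y x then 1 else 0) \<partial>lborel \<partial>M)"
    by (intro nn_integral_cong) (auto split: split_indicator)
  also have "\<dots> = (\<integral>\<^sup>+y. \<integral>\<^sup>+x. (if 0 < y \<and> y < Y x then 1 else 0) \<partial>M \<partial>lborel)"
    by (rule P.Fubini'[symmetric]) measurable
  also have "\<dots> = (\<integral>\<^sup>+y. ?g y \<partial>lborel)"
  proof (intro nn_integral_cong)
    fix y :: real
    have "(\<integral>\<^sup>+x. (if 0 < y \<and> y < Y x then 1 else 0) \<partial>M)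
        = (\<integral>\<^sup>+x. indicator {0<..} y * indicator {x \<in> space M. y < Y x} x \<partial>M)"
      by (intro nn_integral_cong) (auto split: split_indicator)
    then show "(\<integral>\<^sup>+x. (if 0 < y \<and> y < Y x then 1 else 0) \<partial>M) = ennreal (?g y)"
      by (simp add: nn_integral_cmult emeasure_eq_measure ennreal_mult ennreal_indicator)
  qed
  finally have eq: "(\<integral>\<^sup>+y. ?g y \<partial>lborel) = ennreal (expectation Y)"
    using nn_integral_eq_integral[OF int nonneg] by simp
  \<comment> \<open>A nonnegative integral with a real value gives integrability of the tail and its
    integral at once.\<close>
  have "has_bochner_integral lborel ?g (expectation Y)"
    using eq nonneg by (intro has_bochner_integral_nn_integral integral_nonneg_AE) auto
  then show "set_integrable lborel {0<..} (\<lambda>y. prob {x \<in> space M. y < Y x})"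
    and "expectation Y = (LINT y:{0<..}|lborel. prob {x \<in> space M. y < Y x})"
    unfolding set_integrable_def set_lebesgue_integral_def
    by (auto simp: has_bochner_integral_iff)
qed

section \<open>The exponential integral of imaginary order\<close>

text \<open>Up to the factor \<open>1 / z\<close> this is the exponential density times
  \<open>x ^ k\<close>, and all moments of the exponential distribution are finite.\<close>

lemma set_integrable_power_mult_exp:
  fixes z :: real
  assumes z: "0 < z"
  shows "set_integrable lborel {1<..} (\<lambda>u. u ^ k * exp (- z * u))"
proof -
  have "integrable lborel (\<lambda>x. exponential_density z x * x ^ k)"
  proof (rule integrableI_nonneg)
    show "(\<integral>\<^sup>+x. ennreal (exponential_density z x * x ^ k) \<partial>lborel) < \<infinity>"
      by (subst nn_integral_erlang_ith_moment[OF z]) simp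
  qed (auto simp: exponential_density_def z less_imp_le)
  then have "integrable lborel (\<lambda>x. 1 / z * (exponential_density z x * x ^ k))"
    by (rule integrable_mult_right)
  then have "set_integrable lborel {1<..} (\<lambda>x. 1 / z * (exponential_density z x * x ^ k))"
    unfolding set_integrable_def by (intro integrable_mult_indicator) auto
  then show ?thesis
    by (rule set_integrable_cong[THEN iffD1, rotated -1])
       (use z in \<open>auto simp: exponential_density_def mult.commute\<close>)
qed

text \<open>On positive reals the principal power of order \<open>\<i> * t\<close> is the pure phase
  \<open>iexp (t * ln u)\<close>. The endpoint \<open>1\<close> is a null set, so the closed ray may
  be replaced by the open one.\<close>

lemma expint_E_imaginary_order:
  "expint_E (- \<i> * of_real t) z = (LBINT u=1..\<infinity>. iexp (t * ln u) * of_real (exp (- z * u)))"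
proof -
  have "expint_E (- \<i> * of_real t) z
      = (\<integral>u. indicator {1..} u *\<^sub>R (iexp (t * ln u) * of_real (exp (- z * u))) \<partial>lborel)"
    unfolding expint_E_def set_lebesgue_integral_def
    by (intro Bochner_Integration.integral_cong refl)
       (auto simp: powr_def Ln_of_real mult.assoc split: split_indicator)
  also have "\<dots> = (\<integral>u. indicator {1<..} u *\<^sub>R (iexp (t * ln u) * of_real (exp (- z * u))) \<partial>lborel)"
    using AE_lborel_singleton[of "1::real"]
    by (intro integral_cong_AE) (auto elim!: eventually_mono split: split_indicator)
  finally show ?thesis
    by (simp add: interval_integral_to_infinity_eq one_ereal_def set_lebesgue_integral_def)
qed

text \<open>The phase has modulus one, so \<open>g\<close> dominates the product.\<close>

lemma set_integrable_iexp_mult: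
  fixes f g :: "real \<Rightarrow> real"
  assumes "set_integrable lborel A g" and [measurable]: "f \<in> borel_measurable borel"
  shows "set_integrable lborel A (\<lambda>u. iexp (f u) * of_real (g u))"
proof -
  \<comment> \<open>The indicator stays attached to \<open>g\<close>, because the hypothesis gives
    measurability only for their product.\<close>
  have "integrable lborel (\<lambda>u. iexp (f u) * of_real (indicator A u *\<^sub>R g u))"
  proof (rule Bochner_Integration.integrable_bound)
    show "integrable lborel (\<lambda>u. indicator A u *\<^sub>R g u)"
      using assms(1) unfolding set_integrable_def .
    then have [measurable]: "(\<lambda>u. indicator A u *\<^sub>R g u) \<in> borel_measurable borel"
      by simp
    show "(\<lambda>u. iexp (f u) * of_real (indicator A u *\<^sub>R g u)) \<in> borel_measurable lborel"
      by measurable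
  qed (simp add: norm_mult)
  then show ?thesis
    unfolding set_integrable_def
    by (rule Bochner_Integration.integrable_cong[THEN iffD1, rotated -1]) (auto simp: scaleR_conv_of_real)
qed

text \<open>Integration by parts, with \<open>I\<close> the integral of \<open>?e\<close> and
  \<open>J\<close> that of \<open>?g\<close>, gives
  \<open>(1 + \<i> * t) * I = z * J - exp (- z)\<close>. The factor on the left has modulus at least
  \<open>t\<close>, and \<open>J\<close> is bounded independently of \<open>t\<close>.\<close>

lemma expint_E_decay:
  assumes z: "0 < z" and t: "0 < t"
  shows "cmod (expint_E (- \<i> * of_real t) z)
           \<le> (exp (- z) + z * (LINT u:{1<..}|lborel. u * exp (- z * u))) / t"
proof -
  let ?e = "\<lambda>u. iexp (t * ln u) * of_real (exp (- z * u))"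
  let ?g = "\<lambda>u. iexp (t * ln u) * of_real (u * exp (- z * u))"
  \<comment> \<open>The exponent in \<open>?g\<close>, which is \<open>u\<close> to the power
    \<open>1 + \<i> * t\<close> times \<open>exp (- z * u)\<close>; differentiation brings it down
    as a factor.\<close>
  define c where "c = 1 + \<i> * of_real t"
  have c0: "c \<noteq> 0"
    by (simp add: c_def complex_eq_iff)
  have "t \<le> cmod c"
    using abs_Im_le_cmod[of c] t by (simp add: c_def)
  have int_e: "set_integrable lborel {1<..} ?e"
    using set_integrable_power_mult_exp[OF z, of 0]
    by (intro set_integrable_iexp_mult) auto
  have int_g: "set_integrable lborel {1<..} ?g"
    using set_integrable_power_mult_exp[OF z, of 1]
    by (intro set_integrable_iexp_mult) auto
  have ein: "einterval 1 \<infinity> = {1::real<..}"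
    by (auto simp: einterval_def one_ereal_def)
  \<comment> \<open>The integrand is the derivative of \<open>?g\<close>, which vanishes at infinity
    and equals \<open>exp (- z)\<close> at \<open>1\<close>.\<close>
  have "(LBINT u=1..\<infinity>. c * ?e u - z * ?g u) = 0 - ?g 1"
  proof (rule interval_integral_FTC_integrable[where F="?g"])
    show "(?g has_vector_derivative c * ?e u - z * ?g u) (at u)" if "1 < ereal u" for u
    proof -
      have u: "0 < u" using that by (simp add: one_ereal_def)
      have "((\<lambda>u. iexp (t * ln u)) has_vector_derivative (t / u) *\<^sub>R (\<i> * iexp (t * ln u))) (at u)"
        using u by (intro vector_diff_chain_at[where g=iexp and f="\<lambda>u. t * ln u", unfolded o_def]
            has_vector_derivative_iexp)
          (auto intro!: derivative_eq_intros simp flip: has_real_derivative_iff_has_vector_derivative)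
      moreover have "((\<lambda>u. complex_of_real (u * exp (- z * u))) has_vector_derivative
          of_real (exp (- z * u) - z * u * exp (- z * u))) (at u)"
        by (intro has_vector_derivative_of_real)
           (auto intro!: derivative_eq_intros simp flip: has_real_derivative_iff_has_vector_derivative)
      ultimately have "(?g has_vector_derivative
          iexp (t * ln u) * of_real (exp (- z * u) - z * u * exp (- z * u))
           + ((t / u) *\<^sub>R (\<i> * iexp (t * ln u))) * of_real (u * exp (- z * u))) (at u)"
        by (rule has_vector_derivative_mult)
      then show ?thesis
        by (rule has_vector_derivative_eq_rhs)
           (use u in \<open>simp add: c_def scaleR_conv_of_real field_simps\<close>)
    qed
    show "isCont (\<lambda>u. c * ?e u - z * ?g u) u" if "1 < ereal u" for u
      using that by (intro continuous_intros) (auto simp: one_ereal_def)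
    show "set_integrable lborel (einterval 1 \<infinity>) (\<lambda>u. c * ?e u - z * ?g u)"
      unfolding ein by (intro set_integral_diff set_integrable_mult_right int_e int_g)
    have "isCont ?g 1"
      by (intro continuous_intros) auto
    then show "((?g \<circ> real_of_ereal) \<longlongrightarrow> ?g 1) (at_right 1)"
      unfolding one_ereal_def ereal_tendsto_simps1
      by (simp add: isCont_def filterlim_at_split)
    have "((\<lambda>u. u * exp (- z * u)) \<longlongrightarrow> 0) at_top"
      using z by real_asymp
    then have "((\<lambda>u. norm (?g u)) \<longlongrightarrow> 0) at_top"
      by (rule Lim_transform_eventually[OF _ eventually_mono[OF eventually_ge_at_top[of 0]]])
         (simp add: norm_mult)
    then show "((?g \<circ> real_of_ereal) \<longlongrightarrow> 0) (at_left \<infinity>)"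
      unfolding ereal_tendsto_simps1 by (rule tendsto_norm_zero_cancel)
  qed simp
  then have "(LINT u:{1<..}|lborel. c * ?e u - z * ?g u) = - of_real (exp (- z))"
    by (simp add: interval_integral_to_infinity_eq one_ereal_def)
  moreover define I J where "I = (LINT u:{1<..}|lborel. ?e u)" and "J = (LINT u:{1<..}|lborel. ?g u)"
  have "(LINT u:{1<..}|lborel. c * ?e u - z * ?g u) = c * I - z * J"
    using set_integral_diff(2)[OF set_integrable_mult_right[of c, OF int_e]
        set_integrable_mult_right[of "of_real z", OF int_g]]
    by (simp only: set_integral_mult_right I_def J_def)
  ultimately have "c * I = z * J - of_real (exp (- z))"
    by (simp add: algebra_simps)
  then have "cmod c * cmod I \<le> z * cmod J + exp (- z)"
    using norm_triangle_ineq4[of "z * J" "of_real (exp (- z))"] z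
    by (simp add: norm_mult flip: norm_mult[of c])
  also have "cmod J \<le> (LINT u:{1<..}|lborel. u * exp (- z * u))"
  proof -
    have "cmod J \<le> (LINT u:{1<..}|lborel. norm (?g u))"
      unfolding J_def by (rule set_integral_norm_bound[OF int_g])
    also have "\<dots> = (LINT u:{1<..}|lborel. u * exp (- z * u))"
      by (intro set_lebesgue_integral_cong) (auto simp: norm_mult)
    finally show ?thesis .
  qed
  finally have "cmod c * cmod I \<le> exp (- z) + z * (LINT u:{1<..}|lborel. u * exp (- z * u))"
    using z by simp
  moreover have "t * cmod I \<le> cmod c * cmod I"
    using \<open>t \<le> cmod c\<close> by (intro mult_right_mono) auto
  moreover have "expint_E (- \<i> * of_real t) z = I"
    unfolding expint_E_imaginary_order I_def by (simp add: interval_integral_to_infinity_eq one_ereal_def)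
  ultimately show ?thesis
    using t by (simp add: field_simps)
qed

text \<open>Under \<open>u = 1 + x\<close> the phase becomes a power of \<open>u\<close>, and the
  density \<open>exp (- x / \<rho>) / \<rho>\<close> contributes the extra factor
  \<open>exp (1 / \<rho>)\<close>. Its support \<open>x \<ge> 0\<close> becomes the range
  \<open>u \<ge> 1\<close> of the exponential integral.\<close>

lemma (in prob_space) char_ln_one_plus_exponential:
  assumes \<rho>: "0 < \<rho>" and X: "distributed M lborel X (exponential_density (1 / \<rho>))"
  shows "char (distr M borel (\<lambda>\<omega>. ln (1 + X \<omega>))) t
           = of_real (exp (1 / \<rho>) / \<rho>) * expint_E (- \<i> * of_real t) (1 / \<rho>)"
proof -
  have [measurable]: "X \<in> borel_measurable M"
    using distributed_measurable[OF X] by simp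
  have "char (distr M borel (\<lambda>\<omega>. ln (1 + X \<omega>))) t = (\<integral>\<omega>. iexp (t * ln (1 + X \<omega>)) \<partial>M)"
    by (simp add: char_def integral_distr)
  also have "\<dots> = (\<integral>x. iexp (t * ln (1 + x)) \<partial>distr M lborel X)"
    by (simp add: integral_distr)
  also have "\<dots> = (\<integral>x. exponential_density (1 / \<rho>) x *\<^sub>R iexp (t * ln (1 + x)) \<partial>lborel)"
    unfolding distributed_distr_eq_density[OF X]
    by (rule integral_density) (use \<rho> in \<open>auto simp: exponential_density_nonneg\<close>)
  also have "\<dots> = (\<integral>u. exponential_density (1 / \<rho>) (- 1 + 1 * u) *\<^sub>R iexp (t * ln (1 + (- 1 + 1 * u))) \<partial>lborel)"
    by (subst lborel_integral_real_affine[where c=1 and t="-1"]) simp_all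
  also have "\<dots> = (\<integral>u. of_real (exp (1 / \<rho>) / \<rho>) *
      (indicator {1..} u *\<^sub>R (complex_of_real u powr (- (- \<i> * of_real t)) * of_real (exp (- (1 / \<rho>) * u)))) \<partial>lborel)"
  proof (intro Bochner_Integration.integral_cong refl)
    fix u :: real
    have "exp ((1 - u) / \<rho>) = exp (1 / \<rho>) * exp (- (u / \<rho>))"
      by (simp add: diff_divide_distrib flip: exp_add)
    then show "exponential_density (1 / \<rho>) (- 1 + 1 * u) *\<^sub>R iexp (t * ln (1 + (- 1 + 1 * u)))
      = of_real (exp (1 / \<rho>) / \<rho>) *
      (indicator {1..} u *\<^sub>R (complex_of_real u powr (- (- \<i> * of_real t)) * of_real (exp (- (1 / \<rho>) * u))))"
      by (auto simp: exponential_density_def powr_def Ln_of_real scaleR_conv_of_real mult_ac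
          simp del: of_real_exp split: split_indicator)
  qed
  finally show ?thesis
    unfolding expint_E_def set_lebesgue_integral_def integral_mult_right_zero .
qed

section \<open>The mean of a minimum of independent variables\<close>

text \<open>A finite nonempty minimum exceeds \<open>y\<close> exactly when every member does, and
  these events are independent.\<close>

lemma (in prob_space) prob_less_MIN:
  fixes S :: "'i \<Rightarrow> 'a \<Rightarrow> real"
  assumes "indep_vars (\<lambda>_. borel) S A" "finite A" "A \<noteq> {}"
  shows "prob {\<omega> \<in> space M. y < (MIN i\<in>A. S i \<omega>)} = (\<Prod>i\<in>A. prob {\<omega> \<in> space M. y < S i \<omega>})"
proof -
  have "{\<omega> \<in> space M. y < (MIN i\<in>A. S i \<omega>)} = (\<Inter>i\<in>A. S i -` {y<..} \<inter> space M)"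
    using assms by auto
  moreover have "S i -` {y<..} \<inter> space M = {\<omega> \<in> space M. y < S i \<omega>}" for i
    by auto
  ultimately show ?thesis
    using indep_varsD_finite[OF assms(1,3,2), of "\<lambda>_. {y<..}"] by simp
qed

text \<open>A probability distribution has at most countably many atoms, and countable sets are
  Lebesgue null.\<close>

lemma (in prob_space) AE_lborel_not_atom:
  fixes X :: "'a \<Rightarrow> real"
  assumes [measurable]: "random_variable borel X"
  shows "AE y in lborel. measure (distr M borel X) {y} = 0"
proof -
  interpret D: real_distribution "distr M borel X"
    by simp
  have "{y. measure (distr M borel X) {y} \<noteq> 0} \<in> null_sets lborel"
    by (intro countable_imp_null_set_lborel D.countable_support)
  then show ?thesis
    by (rule AE_I') auto
qed

text \<open>
  The inversion formula only yields \<open>P (S > y) + P (S = y) / 2\<close>; the atoms are dropped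
  since there are only countably many of them and \<open>y\<close> is integrated out.
\<close>

theorem (in prob_space) expectation_MIN_char:
  fixes S :: "'i \<Rightarrow> 'a \<Rightarrow> real" and \<phi> :: "real \<Rightarrow> complex"
  defines "h \<equiv> \<lambda>y t. Im (iexp (- (y * t)) * \<phi> t) / t"
  defines "P \<equiv> \<lambda>y. 1 / 2 + 1 / pi * (LINT t:{0<..}|lborel. h y t)"
  assumes A: "finite A" "A \<noteq> {}" and indep: "indep_vars (\<lambda>_. borel) S A"
    and int: "\<And>i. i \<in> A \<Longrightarrow> integrable M (S i)"
    and nonneg: "\<And>i. i \<in> A \<Longrightarrow> AE \<omega> in M. 0 \<le> S i \<omega>"
    and \<phi>: "\<And>i t. i \<in> A \<Longrightarrow> char (distr M borel (S i)) t = \<phi> t"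
    and decay: "\<And>t. 1 \<le> t \<Longrightarrow> cmod (\<phi> t) \<le> C / t"
  shows "set_integrable lborel {0<..} (h y)"
    and "set_integrable lborel {0<..} (\<lambda>y. P y ^ card A)"
    and "expectation (\<lambda>\<omega>. MIN i\<in>A. S i \<omega>) = (LINT y:{0<..}|lborel. P y ^ card A)"
proof -
  have meas [measurable]: "random_variable borel (S i)" if "i \<in> A" for i
    using int[OF that] by simp
  have moment: "integrable (distr M borel (S i)) (\<lambda>x. x)" if "i \<in> A" for i
    using int that by (subst integrable_distr_eq) auto
  have decay': "cmod (char (distr M borel (S i)) t) \<le> C / t" if "i \<in> A" "1 \<le> t" for i t
    using decay \<phi> that by simp
  have GP: "set_integrable lborel {0<..} (h y)"
      "P y = measure (distr M borel (S i)) {y<..} + measure (distr M borel (S i)) {y} / 2"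
    if i: "i \<in> A" for i y
    using real_distribution.Gil_Pelaez_integrable[OF _ moment[OF i] decay'[OF i], of y]
      real_distribution.Gil_Pelaez[OF _ moment[OF i] decay'[OF i], of y] i
    by (simp_all only: h_def P_def \<phi> real_distribution_distr meas)
  \<comment> \<open>Any index will do: \<open>h\<close> and \<open>P\<close> depend only on the
    common characteristic function \<open>\<phi>\<close>.\<close>
  from A obtain j where j: "j \<in> A"
    by auto
  show "set_integrable lborel {0<..} (h y)"
    by (rule GP[OF j])
  interpret D: real_distribution "distr M borel (S j)"
    using j by simp
  have \<phi>_eq: "\<phi> = char (distr M borel (S j))"
    using \<phi>[OF j] by auto
  \<comment> \<open>Measurability of \<open>\<phi>\<close> is inherited from its being a
    characteristic function.\<close>
  have [measurable]: "P \<in> borel_measurable borel"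
    unfolding P_def h_def \<phi>_eq set_lebesgue_integral_def by measurable
  let ?Z = "\<lambda>\<omega>. MIN i\<in>A. S i \<omega>"
  have intZ: "integrable M ?Z"
    using A int by (rule integrable_MIN)
  then have [measurable]: "random_variable borel ?Z"
    by simp
  have "AE \<omega> in M. \<forall>i\<in>A. 0 \<le> S i \<omega>"
    using A nonneg by (intro AE_finite_allI)
  then have nonnegZ: "AE \<omega> in M. 0 \<le> ?Z \<omega>"
    using A by (auto elim!: eventually_mono)
  \<comment> \<open>As \<open>A\<close> is finite, one null set of \<open>y\<close> covers the atoms
    of all the \<open>S i\<close>; off it each tail equals \<open>P y\<close>.\<close>
  have "AE y in lborel. \<forall>i\<in>A. measure (distr M borel (S i)) {y} = 0"
    using A by (intro AE_finite_allI AE_lborel_not_atom meas)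
  then have "AE y in lborel. prob {\<omega> \<in> space M. y < ?Z \<omega>} = P y ^ card A"
  proof eventually_elim
    case (elim y)
    have "prob {\<omega> \<in> space M. y < S i \<omega>} = P y" if i: "i \<in> A" for i
    proof -
      have "S i -` {y<..} \<inter> space M = {\<omega> \<in> space M. y < S i \<omega>}"
        by auto
      then show ?thesis
        using GP(2)[OF i, of y] elim i by (simp add: measure_distr)
    qed
    then show ?case
      by (simp add: prob_less_MIN[OF indep A])
  qed
  then have eq: "AE y \<in> {0<..} in lborel. prob {\<omega> \<in> space M. y < ?Z \<omega>} = P y ^ card A"
    by (rule eventually_mono) simp
  have m: "(\<lambda>y. prob {\<omega> \<in> space M. y < ?Z \<omega>}) \<in> borel_measurable lborel"
    "(\<lambda>y. P y ^ card A) \<in> borel_measurable lborel"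
    by measurable
  show "set_integrable lborel {0<..} (\<lambda>y. P y ^ card A)"
    using layer_cake(1)[OF intZ nonnegZ] set_integrable_cong_AE[OF m eq] by simp
  show "expectation ?Z = (LINT y:{0<..}|lborel. P y ^ card A)"
    using layer_cake(2)[OF intZ nonnegZ] set_lebesgue_integral_cong_AE[OF _ m eq] by simp
qed

section \<open>Independence and integrability of the logarithmic rates\<close>

text \<open>The rows \<open>{i} \<times> J\<close> are disjoint blocks of an independent family, so
  the blocks are independent, and so are measurable functions of them.\<close>

lemma (in prob_space) indep_vars_sum_rows:
  fixes X :: "'i \<Rightarrow> 'j \<Rightarrow> 'a \<Rightarrow> real"
  assumes indep: "indep_vars (\<lambda>_. borel) (\<lambda>(i, j). X i j) (I \<times> J)"
    and f [measurable]: "f \<in> borel_measurable borel"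
    and "A \<subseteq> I"
  shows "indep_vars (\<lambda>_. borel) (\<lambda>i \<omega>. \<Sum>j\<in>J. f (X i j \<omega>) :: real) A"
proof -
  have "indep_vars (\<lambda>i. PiM ({i} \<times> J) (\<lambda>_. borel))
      (\<lambda>i \<omega>. restrict (\<lambda>p. (case p of (i, j) \<Rightarrow> X i j) \<omega>) ({i} \<times> J)) A"
    using \<open>A \<subseteq> I\<close> by (intro indep_vars_restrict[OF indep]) (auto simp: disjoint_family_on_def)
  then have "indep_vars (\<lambda>_. borel)
      (\<lambda>i \<omega>. (\<lambda>v. \<Sum>j\<in>J. f (v (i, j))) (restrict (\<lambda>p. (case p of (i, j) \<Rightarrow> X i j) \<omega>) ({i} \<times> J))) A"
    by (rule indep_vars_compose2) measurable
  then show ?thesis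
    by (simp cong: sum.cong)
qed

text \<open>Taking the singletons \<open>{(i, j)}\<close> as blocks also changes the index from
  pairs to \<open>j\<close> alone.\<close>

lemma (in prob_space) indep_vars_row:
  fixes X :: "'i \<Rightarrow> 'j \<Rightarrow> 'a \<Rightarrow> real"
  assumes indep: "indep_vars (\<lambda>_. borel) (\<lambda>(i, j). X i j) (I \<times> J)"
    and f [measurable]: "f \<in> borel_measurable borel"
    and "i \<in> I"
  shows "indep_vars (\<lambda>_. borel) (\<lambda>j \<omega>. f (X i j \<omega>) :: real) J"
proof -
  have "indep_vars (\<lambda>j. PiM {(i, j)} (\<lambda>_. borel))
      (\<lambda>j \<omega>. restrict (\<lambda>p. (case p of (i, j) \<Rightarrow> X i j) \<omega>) {(i, j)}) J"
    using \<open>i \<in> I\<close> by (intro indep_vars_restrict[OF indep]) (auto simp: disjoint_family_on_def)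
  then have "indep_vars (\<lambda>_. borel)
      (\<lambda>j \<omega>. (\<lambda>v. f (v (i, j))) (restrict (\<lambda>p. (case p of (i, j) \<Rightarrow> X i j) \<omega>) {(i, j)})) J"
    by (rule indep_vars_compose2) measurable
  then show ?thesis
    by simp
qed

lemma (in prob_space) exponential_AE_nonneg:
  assumes "0 < l" and X: "distributed M lborel X (exponential_density l)"
  shows "AE \<omega> in M. 0 \<le> X \<omega>"
  by (subst distributed_AE2[OF X]) (auto simp: exponential_density_def)

text \<open>For \<open>x \<ge> 0\<close> the logarithm lies between \<open>0\<close> and
  \<open>x\<close>, and the exponential distribution has a finite mean.\<close>

lemma (in prob_space) exponential_integrable_ln_one_plus:
  assumes "0 < l" and X: "distributed M lborel X (exponential_density l)"
  shows "integrable M (\<lambda>\<omega>. ln (1 + X \<omega>))"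
proof (rule Bochner_Integration.integrable_bound)
  show "integrable M X"
    using erlang_ith_moment_integrable[OF assms, of 1] by simp
  then show "(\<lambda>\<omega>. ln (1 + X \<omega>)) \<in> borel_measurable M"
    by measurable
  show "AE \<omega> in M. norm (ln (1 + X \<omega>)) \<le> norm (X \<omega>)"
    using exponential_AE_nonneg[OF assms]
    by eventually_elim (simp add: ln_add_one_self_le_self)
qed

section \<open>The average rate of the ACC scheme\<close>

text \<open>The integral of a non-integrable function is \<open>0\<close> by convention; the three
  integrability clauses ensure that the rate formula speaks of genuine integrals.\<close>

theorem lemma1:
  fixes M :: "'w measure"
    and \<Lambda> B :: nat
    and \<gamma> \<rho> :: real
    and \<G> :: "nat set"
    and SNR :: "nat \<Rightarrow> nat \<Rightarrow> 'w \<Rightarrow> real"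
  assumes "prob_space M"
    and "1 \<le> B"
    and "0 < \<rho>"
    and "0 \<le> \<gamma>" and "\<gamma> \<le> 1"
    and "real \<Lambda> * \<gamma> \<in> \<int>"
    and "real \<Lambda> * \<gamma> + 1 \<le> real \<Lambda>"
    and "\<G> \<subseteq> {1..\<Lambda>}"
    and "real (card \<G>) = real \<Lambda> * \<gamma> + 1"
    and "\<And>g b. g \<in> {1..\<Lambda>} \<Longrightarrow> b \<in> {1..B} \<Longrightarrow>
           distributed M lborel (SNR g b) (exponential_density (1 / \<rho>))"
    and "prob_space.indep_vars M (\<lambda>_. borel) (\<lambda>(g, b). SNR g b) ({1..\<Lambda>} \<times> {1..B})"
  shows "integrable M (acc_min_rate SNR B \<G>)
    \<and> (\<forall>y>0. set_integrable lborel {0<..} (acc_integrand B \<rho> y))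
    \<and> set_integrable lborel {0<..}
        (\<lambda>y. (1 / 2 + 1 / pi * (LINT t:{0<..}|lborel. acc_integrand B \<rho> y t)) ^ card \<G>)
    \<and> acc_avg_rate M SNR B \<G> =
        real (card \<G>) / (real B * ln 2)
        * (LINT y:{0<..}|lborel.
             (1 / 2 + 1 / pi * (LINT t:{0<..}|lborel. acc_integrand B \<rho> y t)) ^ card \<G>)"
proof -
  interpret prob_space M
    by (fact assms(1))
  note \<rho> = \<open>0 < \<rho>\<close>
  then have l: "0 < 1 / \<rho>"
    by simp
  have dist: "distributed M lborel (SNR g b) (exponential_density (1 / \<rho>))"
    if "g \<in> \<G>" "b \<in> {1..B}" for g b
    using assms(8,10) that by blast
  \<comment> \<open>Positivity yields both facts below, since \<open>card\<close> is
    \<open>0\<close> on infinite sets as well as on the empty one.\<close>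
  have "0 < real (card \<G>)"
    using assms(4,9) by (simp add: add_nonneg_pos)
  then have fin: "finite \<G>" and ne: "\<G> \<noteq> {}"
    using card_gt_0_iff[of \<G>] by auto
  define S where "S = (\<lambda>g \<omega>. \<Sum>b=1..B. ln (1 + SNR g b \<omega>))"
  define K where "K = exp (1 / \<rho>) / \<rho>"
  define E where "E = (\<lambda>t. expint_E (- \<i> * complex_of_real t) (1 / \<rho>))"
  define \<phi> where "\<phi> = (\<lambda>t. (complex_of_real K * E t) ^ B)"
  have ln_meas: "(\<lambda>x::real. ln (1 + x)) \<in> borel_measurable borel"
    by measurable
  have indep: "indep_vars (\<lambda>_. borel) S \<G>"
    unfolding S_def by (rule indep_vars_sum_rows[OF assms(11) ln_meas assms(8)])
  have int: "integrable M (S g)" if "g \<in> \<G>" for g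
    unfolding S_def using that
    by (intro Bochner_Integration.integrable_sum exponential_integrable_ln_one_plus[OF l] dist)
  have nonneg: "AE \<omega> in M. 0 \<le> S g \<omega>" if "g \<in> \<G>" for g
  proof -
    have "AE \<omega> in M. \<forall>b\<in>{1..B}. 0 \<le> SNR g b \<omega>"
      using that by (intro AE_finite_allI exponential_AE_nonneg[OF l] dist) auto
    then show ?thesis
      unfolding S_def by eventually_elim (auto intro!: sum_nonneg)
  qed
  have char_ln: "char (distr M borel (\<lambda>\<omega>. ln (1 + SNR g b \<omega>))) t = of_real K * E t"
    if "g \<in> \<G>" "b \<in> {1..B}" for g b t
    unfolding K_def E_def by (rule char_ln_one_plus_exponential[OF \<rho> dist[OF that]])
  have char_S: "char (distr M borel (S g)) t = \<phi> t" if g: "g \<in> \<G>" for g t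
  proof -
    have "indep_vars (\<lambda>_. borel) (\<lambda>b \<omega>. ln (1 + SNR g b \<omega>)) {1..B}"
      using assms(8) g by (intro indep_vars_row[OF assms(11) ln_meas]) auto
    then show ?thesis
      unfolding S_def \<phi>_def using char_ln[OF g] by (subst char_distr_sum) simp_all
  qed
  \<comment> \<open>\<open>K\<close> times the constant of \<open>expint_E_decay\<close> at
    \<open>z = 1 / \<rho>\<close>.\<close>
  define C where "C = K * (exp (- (1 / \<rho>)) + 1 / \<rho> * (LINT u:{1<..}|lborel. u * exp (- (1 / \<rho>) * u)))"
  have K0: "0 < K"
    using \<rho> by (simp add: K_def)
  have decay: "cmod (\<phi> t) \<le> C / t" if t: "1 \<le> t" for t
  proof -
    obtain g where g: "g \<in> \<G>"
      using ne by auto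
    \<comment> \<open>A single factor is a characteristic function, hence of modulus at most
      \<open>1\<close>. Its \<open>B\<close>-th power is therefore no larger than the factor itself,
      whose \<open>1 / t\<close> decay suffices.\<close>
    have "cmod (of_real K * E t) = cmod (char (distr M borel (\<lambda>\<omega>. ln (1 + SNR g 1 \<omega>))) t)"
      using char_ln[OF g, of 1] \<open>1 \<le> B\<close> by simp
    also have "\<dots> \<le> 1"
      using distributed_measurable[OF dist[OF g, of 1]] \<open>1 \<le> B\<close>
      by (intro real_distribution.cmod_char_le_1 real_distribution_distr) auto
    finally have le1: "cmod (of_real K * E t) \<le> 1" .
    have "cmod (\<phi> t) = cmod (of_real K * E t) ^ B"
      by (simp add: \<phi>_def norm_power)
    also have "\<dots> \<le> cmod (of_real K * E t) ^ 1"
      using le1 \<open>1 \<le> B\<close> by (intro power_decreasing) auto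
    also have "\<dots> = K * cmod (E t)"
      using K0 by (simp add: norm_mult)
    also have "\<dots> \<le> C / t"
      using mult_left_mono[OF expint_E_decay[OF l, of t], of K] K0 t
      by (simp add: C_def E_def)
    finally show ?thesis .
  qed
  have integrand: "acc_integrand B \<rho> y t = Im (iexp (- (y * t)) * \<phi> t) / t" for y t
  proof -
    have "complex_of_real (exp (real B / \<rho>) / \<rho> ^ B) = of_real K ^ B"
      by (simp add: K_def power_divide exp_of_nat_mult[symmetric] flip: of_real_power)
    then show ?thesis
      by (simp add: acc_integrand_def \<phi>_def E_def power_mult_distrib mult.assoc del: times_complex.sel)
  qed
  have min_rate: "acc_min_rate SNR B \<G> \<omega> = 1 / real B * (MIN g\<in>\<G>. S g \<omega>)" for \<omega>
  proof -
    \<comment> \<open>Scaling by \<open>1 / B\<close> is monotone and commutes with the minimum. The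
      inversion can thus run on the sums, with \<open>B\<close> left in the prefactor.\<close>
    have "1 / real B * Min ((\<lambda>g. S g \<omega>) ` \<G>) = Min ((\<lambda>x. 1 / real B * x) ` (\<lambda>g. S g \<omega>) ` \<G>)"
      using fin ne by (intro mono_Min_commute) (auto intro!: monoI divide_right_mono)
    then show ?thesis
      by (simp add: acc_min_rate_def S_def image_image)
  qed
  note main = expectation_MIN_char[OF fin ne indep int nonneg char_S decay, folded integrand]
  have "integrable M (\<lambda>\<omega>. MIN g\<in>\<G>. S g \<omega>)"
    using fin ne int by (rule integrable_MIN)
  then have "integrable M (acc_min_rate SNR B \<G>)"
    unfolding min_rate[abs_def] by (rule integrable_mult_right)
  moreover have "acc_avg_rate M SNR B \<G> = real (card \<G>) / (real B * ln 2) * expectation (\<lambda>\<omega>. MIN g\<in>\<G>. S g \<omega>)"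
    unfolding acc_avg_rate_def min_rate[abs_def] integral_mult_right_zero by simp
  ultimately show ?thesis
    using main by simp
qed

end
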